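(* 1. If there exists an $(r,t)$-Ruzsa–Szemerédi graph on $n$ vertices, then $\overline{\alpha}_3(\tfrac n2,t)\ge \tfrac{rt}{2}$. 2. If $\overline{\alpha}_3(n,t)\ge rt$, then there exists an $(\tfrac r2,t)$-Ruzsa–Szemerédi graph on $n$ vertices.
   Context: A graph is called an $(r,t)$-Ruzsa–Szemerédi graph if its edge set can be partitioned into $t$ pairwise edge-disjoint induced matchings, each of size $r$ (a matching $M$ in a graph is induced if the subgraph induced on the vertices covered by $M$ has no edges other than those of $M$). For a subgraph $G$ of the complete tripartite graph $K_{m,m,N}$, $\overline{\alpha}_3(G)$ is the largest cardinality of a family of pairwise edge-disjoint triangles in $G$ such that the union of the triangles in the family contains no triangle other than those of the family. $\overline{\alpha}_3(m,N)=\max_G\overline{\alpha}_3(G)$, where the maximum is over all subgraphs $G$ of $K_{m,m,N}$.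
   Formalization: In part 2 the graph has 2n vertices instead of n: as printed the claim fails for n=8, t=7, r=4 (a (2,t)-Ruzsa–Szemerédi graph on 8 vertices has t ≤ 6). The halves n/2 and r/2 are rounded up when n or r is odd. *)

theory Defs
  imports Complex_Main "HOL-Library.Disjoint_Sets"
begin

text \<open>A finite simple graph is a pair \<open>(V, E)\<close> whose edges are two-element subsets of \<open>V\<close>.\<close>

type_synonym 'a graph = "'a set \<times> 'a set set"

definition simple_graph :: "'a graph \<Rightarrow> bool" where
  "simple_graph G \<longleftrightarrow> finite (fst G) \<and> (\<forall>e\<in>snd G. e \<subseteq> fst G \<and> card e = 2)"

definition subgraph :: "'a graph \<Rightarrow> 'a graph \<Rightarrow> bool" where
  "subgraph G H \<longleftrightarrow> simple_graph G \<and> fst G \<subseteq> fst H \<and> snd G \<subseteq> snd H"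

definition matching :: "'a graph \<Rightarrow> 'a set set \<Rightarrow> bool" where
  "matching G M \<longleftrightarrow> M \<subseteq> snd G \<and> pairwise disjnt M"

definition induced_matching :: "'a graph \<Rightarrow> 'a set set \<Rightarrow> bool" where
  "induced_matching G M \<longleftrightarrow> matching G M \<and> {e \<in> snd G. e \<subseteq> \<Union>M} = M"

text \<open>The matchings are indexed, so that \<open>t\<close> is meaningful also for \<open>r = 0\<close>, where the \<open>t\<close>
  matchings are all empty.\<close>

definition Ruzsa_Szemeredi :: "nat \<Rightarrow> nat \<Rightarrow> 'a graph \<Rightarrow> bool" where
  "Ruzsa_Szemeredi r t G \<longleftrightarrow> simple_graph G \<and>
     (\<exists>M. (\<forall>i<t. induced_matching G (M i) \<and> card (M i) = r) \<and>
          disjoint_family_on M {..<t} \<and> (\<Union>i<t. M i) = snd G)"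

definition complete_tripartite :: "nat \<Rightarrow> nat \<Rightarrow> nat \<Rightarrow> (nat \<times> nat) graph" where
  "complete_tripartite a b c =
     (let V = {0} \<times> {..<a} \<union> {1} \<times> {..<b} \<union> {2} \<times> {..<c}
      in (V, {{u, v} | u v. u \<in> V \<and> v \<in> V \<and> fst u \<noteq> fst v}))"

text \<open>A triangle is identified with its set of three vertices.\<close>

definition triangle_edges :: "'a set \<Rightarrow> 'a set set" where
  "triangle_edges T = {e. e \<subseteq> T \<and> card e = 2}"

definition triangles :: "'a graph \<Rightarrow> 'a set set" where
  "triangles G = {T. T \<subseteq> fst G \<and> card T = 3 \<and> triangle_edges T \<subseteq> snd G}"

definition triangle_union :: "'a set set \<Rightarrow> 'a graph" where
  "triangle_union F = (\<Union>F, \<Union>(triangle_edges ` F))"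

definition induced_triangle_packing :: "'a graph \<Rightarrow> 'a set set \<Rightarrow> bool" where
  "induced_triangle_packing G F \<longleftrightarrow>
     F \<subseteq> triangles G \<and>
     (\<forall>S\<in>F. \<forall>T\<in>F. S \<noteq> T \<longrightarrow> triangle_edges S \<inter> triangle_edges T = {}) \<and>
     triangles (triangle_union F) \<subseteq> F"

text \<open>Both maxima below range over finite nonempty sets: the graphs are finite, and the empty
  family and the empty graph are always admissible.\<close>

definition alpha3_bar_graph :: "'a graph \<Rightarrow> nat" where
  "alpha3_bar_graph G = Max {card F | F. induced_triangle_packing G F}"

definition alpha3_bar :: "nat \<Rightarrow> nat \<Rightarrow> nat" where
  "alpha3_bar m N = Max {alpha3_bar_graph G | G. subgraph G (complete_tripartite m m N)}"

end

theory Submission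
  imports Defs
begin

text \<open>A triangle of the complete tripartite graph is a triple \<open>(x, y, i)\<close>, and an induced triangle
  packing is a set of triples in which any two coordinates determine the third and which contains
  \<open>(x, y, i)\<close> as soon as it contains \<open>(x, y, _)\<close>, \<open>(x, _, i)\<close> and \<open>(_, y, i)\<close>. Reading \<open>i\<close> as the
  index of a matching and \<open>{x, y}\<close> as one of its edges, these conditions say that the matchings are
  edge-disjoint and induced in their union, a bipartite graph. Passing from an arbitrary graph to a
  bipartite one costs half of the edges (a balanced cut); making the matchings equally large costs
  half of their average size.\<close>

section \<open>Triangles of the complete tripartite graph as triples\<close>

definition tri :: "nat \<times> nat \<times> nat \<Rightarrow> (nat \<times> nat) set" where
  "tri = (\<lambda>(x, y, i). {(0, x), (1, y), (2, i)})"

definition triple_system :: "nat \<Rightarrow> nat \<Rightarrow> (nat \<times> nat \<times> nat) set \<Rightarrow> bool" where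
  "triple_system m N P \<longleftrightarrow> P \<subseteq> {..<m} \<times> {..<m} \<times> {..<N} \<and>
     (\<forall>x y i j. (x, y, i) \<in> P \<longrightarrow> (x, y, j) \<in> P \<longrightarrow> i = j) \<and>
     (\<forall>x y z i. (x, y, i) \<in> P \<longrightarrow> (x, z, i) \<in> P \<longrightarrow> y = z) \<and>
     (\<forall>x y z i. (x, y, i) \<in> P \<longrightarrow> (z, y, i) \<in> P \<longrightarrow> x = z) \<and>
     (\<forall>x y i x' y' j. (x, y, j) \<in> P \<longrightarrow> (x, y', i) \<in> P \<longrightarrow> (x', y, i) \<in> P \<longrightarrow> (x, y, i) \<in> P)"

lemma finite_triple_system: "triple_system m N P \<Longrightarrow> finite P"
  by (rule finite_subset[of P "{..<m} \<times> {..<m} \<times> {..<N}"]) (simp_all add: triple_system_def)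

lemma tri_eq_iff [simp]: "tri p = tri q \<longleftrightarrow> p = q"
proof
  assume eq: "tri p = tri q"
  obtain x y i x' y' j where pq: "p = (x, y, i)" "q = (x', y', j)" by (cases p, cases q) auto
  have "(0, x) \<in> tri q" "(1, y) \<in> tri q" "(2, i) \<in> tri q"
    unfolding eq[symmetric] by (simp_all add: pq tri_def)
  then show "p = q" by (simp add: pq tri_def)
qed simp

lemma inj_tri: "inj_on tri P"
  by (simp add: inj_on_def)

lemma triangle_edges_three:
  assumes "a \<noteq> b" "a \<noteq> c" "b \<noteq> c"
  shows "triangle_edges {a, b, c} = {{a, b}, {a, c}, {b, c}}"
proof (intro equalityI subsetI)
  fix e assume "e \<in> triangle_edges {a, b, c}"
  then obtain x y where e: "e = {x, y}" "x \<noteq> y" "x \<in> {a, b, c}" "y \<in> {a, b, c}"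
    by (auto simp: triangle_edges_def card_2_iff)
  from e(3,4,2) show "e \<in> {{a, b}, {a, c}, {b, c}}"
    unfolding e(1) insert_iff empty_iff by (elim disjE) (simp_all add: insert_commute)
qed (use assms in \<open>auto simp: triangle_edges_def\<close>)

lemma triangle_edges_tri:
  "triangle_edges (tri (x, y, i)) = {{(0, x), (1, y)}, {(0, x), (2, i)}, {(1, y), (2, i)}}"
  unfolding tri_def by (simp add: triangle_edges_three)

lemma triangles_mono: "fst G \<subseteq> fst H \<Longrightarrow> snd G \<subseteq> snd H \<Longrightarrow> triangles G \<subseteq> triangles H"
  unfolding triangles_def by auto

lemma triangles_complete_tripartite:
  "triangles (complete_tripartite m m N) = tri ` ({..<m} \<times> {..<m} \<times> {..<N})"
proof (intro equalityI subsetI)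
  fix T assume "T \<in> triangles (complete_tripartite m m N)"
  then have T: "T \<subseteq> fst (complete_tripartite m m N)" "card T = 3"
    and e: "triangle_edges T \<subseteq> snd (complete_tripartite m m N)"
    by (auto simp: triangles_def)
  have fin: "finite T" using T(2) by (metis card.infinite zero_neq_numeral)
  \<comment> \<open>No edge joins two vertices of the same class, so the three vertices of a
    triangle lie in three different classes.\<close>
  have inj: "inj_on fst T"
  proof (rule inj_onI, rule ccontr)
    fix u v assume uv: "u \<in> T" "v \<in> T" "fst u = fst v" "u \<noteq> v"
    then have "{u, v} \<in> triangle_edges T" by (auto simp: triangle_edges_def)
    then have "{u, v} \<in> snd (complete_tripartite m m N)" using e by blast
    with uv(3) show False
      by (auto simp: complete_tripartite_def Let_def doubleton_eq_iff)
  qed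
  have "fst ` T \<subseteq> {0, 1, 2}"
    using T(1) by (auto simp: complete_tripartite_def Let_def)
  then have "fst ` T = {0, 1, 2}"
    by (rule card_subset_eq[rotated]) (simp_all add: card_image inj T(2))
  then have "0 \<in> fst ` T" "1 \<in> fst ` T" "2 \<in> fst ` T" by auto
  then obtain x y i where xyi: "(0, x) \<in> T" "(1, y) \<in> T" "(2, i) \<in> T" by fastforce
  have "tri (x, y, i) = T"
    by (rule card_subset_eq) (use fin xyi T(2) in \<open>auto simp: tri_def\<close>)
  moreover have "(x, y, i) \<in> {..<m} \<times> {..<m} \<times> {..<N}"
    using xyi T(1) by (fastforce simp: complete_tripartite_def Let_def)
  ultimately show "T \<in> tri ` ({..<m} \<times> {..<m} \<times> {..<N})" by blast
next
  fix T assume "T \<in> tri ` ({..<m} \<times> {..<m} \<times> {..<N})"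
  then obtain x y i where T: "T = tri (x, y, i)" "x < m" "y < m" "i < N" by auto
  define V where "V = fst (complete_tripartite m m N)"
  have V: "(0, x) \<in> V" "(1, y) \<in> V" "(2, i) \<in> V"
    using T by (auto simp: V_def complete_tripartite_def Let_def)
  have snd_K: "snd (complete_tripartite m m N) = {{u, v} |u v. u \<in> V \<and> v \<in> V \<and> fst u \<noteq> fst v}"
    by (simp add: V_def complete_tripartite_def Let_def)
  have E: "{u, v} \<in> snd (complete_tripartite m m N)" if "u \<in> V" "v \<in> V" "fst u \<noteq> fst v" for u v
    unfolding snd_K using that by blast
  have "triangle_edges T \<subseteq> snd (complete_tripartite m m N)"
    using V by (auto simp: T(1) triangle_edges_tri intro!: E)
  moreover have "T \<subseteq> V" "card T = 3" using V by (auto simp: T(1) tri_def)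
  ultimately show "T \<in> triangles (complete_tripartite m m N)"
    by (simp add: triangles_def V_def)
qed

text \<open>An edge between two given classes fixes exactly the two corresponding coordinates of any
  triple whose triangle contains it. Each of the three edges therefore needs a witness of its own in
  \<open>P\<close>, and the three witnesses may differ.\<close>

lemma tri_in_triangles_union_iff:
  "tri (x, y, i) \<in> triangles (triangle_union (tri ` P)) \<longleftrightarrow>
     (\<exists>j. (x, y, j) \<in> P) \<and> (\<exists>z. (x, z, i) \<in> P) \<and> (\<exists>z. (z, y, i) \<in> P)"
proof -
  have 1: "{(0, x), (1, y)} \<in> (\<Union>p\<in>P. triangle_edges (tri p)) \<longleftrightarrow> (\<exists>j. (x, y, j) \<in> P)"
   and 2: "{(0, x), (2, i)} \<in> (\<Union>p\<in>P. triangle_edges (tri p)) \<longleftrightarrow> (\<exists>z. (x, z, i) \<in> P)"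
   and 3: "{(1, y), (2, i)} \<in> (\<Union>p\<in>P. triangle_edges (tri p)) \<longleftrightarrow> (\<exists>z. (z, y, i) \<in> P)"
    by (simp_all add: Bex_def split_paired_Ex triangle_edges_tri doubleton_eq_iff)
  have "tri (x, y, i) \<in> triangles (triangle_union (tri ` P)) \<longleftrightarrow>
     tri (x, y, i) \<subseteq> \<Union>(tri ` P) \<and> triangle_edges (tri (x, y, i)) \<subseteq> (\<Union>p\<in>P. triangle_edges (tri p))"
    by (auto simp: triangles_def triangle_union_def tri_def)
  also have "\<dots> \<longleftrightarrow> tri (x, y, i) \<subseteq> \<Union>(tri ` P) \<and>
     (\<exists>j. (x, y, j) \<in> P) \<and> (\<exists>z. (x, z, i) \<in> P) \<and> (\<exists>z. (z, y, i) \<in> P)"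
    unfolding triangle_edges_tri insert_subset 1 2 3 by simp
  \<comment> \<open>The condition on vertices is implied: the triangles that supply the edges also
    supply their ends.\<close>
  also have "\<dots> \<longleftrightarrow> (\<exists>j. (x, y, j) \<in> P) \<and> (\<exists>z. (x, z, i) \<in> P) \<and> (\<exists>z. (z, y, i) \<in> P)"
    by (fastforce simp: tri_def)
  finally show ?thesis .
qed

text \<open>Two distinct triangles share an edge iff their triples agree in two coordinates, which
  gives one uniqueness condition for each pair of classes; the closure condition forbids additional
  triangles in the union. \<open>G\<close> enters only by containing the triangles, so the
  equivalence serves both for the full tripartite graph and for its subgraphs.\<close>

lemma induced_triangle_packing_tri_iff:
  assumes P: "P \<subseteq> {..<m} \<times> {..<m} \<times> {..<N}" and G: "tri ` P \<subseteq> triangles G"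
  shows "induced_triangle_packing G (tri ` P) \<longleftrightarrow> triple_system m N P"
proof -
  let ?K = "complete_tripartite m m N"
  have PK: "tri ` P \<subseteq> triangles ?K"
    using P by (auto simp: triangles_complete_tripartite)
  \<comment> \<open>Every triangle of the union is one of the tripartite graph and hence of the form
    \<open>tri p\<close>, so that closure need only be tested on triples.\<close>
  have "triangles (triangle_union (tri ` P)) \<subseteq> triangles ?K"
    by (rule triangles_mono)
       (use PK in \<open>auto simp: triangle_union_def triangles_def\<close>)
  then have "triangles (triangle_union (tri ` P)) \<subseteq> range tri"
    by (auto simp: triangles_complete_tripartite)
  then have "triangles (triangle_union (tri ` P)) \<subseteq> tri ` P \<longleftrightarrow>
     (\<forall>x y i. tri (x, y, i) \<in> triangles (triangle_union (tri ` P)) \<longrightarrow> (x, y, i) \<in> P)"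
    by (auto simp: subset_iff image_iff)
  then have closed: "triangles (triangle_union (tri ` P)) \<subseteq> tri ` P \<longleftrightarrow>
     (\<forall>x y i x' y' j. (x, y, j) \<in> P \<longrightarrow> (x, y', i) \<in> P \<longrightarrow> (x', y, i) \<in> P \<longrightarrow> (x, y, i) \<in> P)"
    unfolding tri_in_triangles_union_iff by blast
  have meet: "triangle_edges (tri (x, y, i)) \<inter> triangle_edges (tri (x', y', j)) = {} \<longleftrightarrow>
     \<not> (x = x' \<and> y = y' \<or> x = x' \<and> i = j \<or> y = y' \<and> i = j)" for x y i x' y' j
    by (auto simp: triangle_edges_tri doubleton_eq_iff)
  have "(\<forall>S\<in>tri ` P. \<forall>T\<in>tri ` P. S \<noteq> T \<longrightarrow> triangle_edges S \<inter> triangle_edges T = {}) \<longleftrightarrow>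
    (\<forall>x y i x' y' j. (x, y, i) \<in> P \<longrightarrow> (x', y', j) \<in> P \<longrightarrow> (x, y, i) \<noteq> (x', y', j) \<longrightarrow>
     \<not> (x = x' \<and> y = y' \<or> x = x' \<and> i = j \<or> y = y' \<and> i = j))"
    unfolding ball_simps(9) tri_eq_iff by (simp only: Ball_def split_paired_All meet) blast
  also have "\<dots> \<longleftrightarrow>
     (\<forall>x y i j. (x, y, i) \<in> P \<longrightarrow> (x, y, j) \<in> P \<longrightarrow> i = j) \<and>
     (\<forall>x y z i. (x, y, i) \<in> P \<longrightarrow> (x, z, i) \<in> P \<longrightarrow> y = z) \<and>
     (\<forall>x y z i. (x, y, i) \<in> P \<longrightarrow> (z, y, i) \<in> P \<longrightarrow> x = z)"
    by blast
  finally show ?thesis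
    unfolding induced_triangle_packing_def triple_system_def using P G closed by simp
qed

section \<open>\<open>alpha3_bar\<close> as the largest size of a triple system\<close>

lemma simple_graph_complete_tripartite: "simple_graph (complete_tripartite a b c)"
proof -
  define V where "V = fst (complete_tripartite a b c)"
  have "snd (complete_tripartite a b c) = {{u, v} |u v. u \<in> V \<and> v \<in> V \<and> fst u \<noteq> fst v}"
    by (simp add: V_def complete_tripartite_def Let_def)
  then have "e \<subseteq> V \<and> card e = 2" if "e \<in> snd (complete_tripartite a b c)" for e
    using that by clarsimp
  moreover have "finite V" by (simp add: V_def complete_tripartite_def Let_def)
  ultimately show ?thesis
    unfolding simple_graph_def V_def[symmetric] by simp
qed

lemma finite_triangles: "finite (fst G) \<Longrightarrow> finite (triangles G)"
  unfolding triangles_def by simp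

lemma finite_induced_triangle_packings:
  assumes "finite (fst G)"
  shows "finite {card F |F. induced_triangle_packing G F}"
proof (rule finite_surj)
  show "finite (Pow (triangles G))" using finite_triangles[OF assms] by simp
  show "{card F |F. induced_triangle_packing G F} \<subseteq> card ` Pow (triangles G)"
    by (auto simp: induced_triangle_packing_def)
qed

lemma induced_triangle_packing_empty: "induced_triangle_packing G {}"
  by (auto simp: induced_triangle_packing_def triangles_def triangle_union_def)

lemma finite_subgraphs:
  assumes "simple_graph H"
  shows "finite {alpha3_bar_graph G |G. subgraph G H}"
proof (rule finite_surj)
  have "snd H \<subseteq> Pow (fst H)" using assms by (auto simp: simple_graph_def)
  then have "finite (fst H)" "finite (snd H)"
    using assms by (auto simp: simple_graph_def intro: finite_subset)
  then show "finite (Pow (fst H) \<times> Pow (snd H))" by simp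
  show "{alpha3_bar_graph G |G. subgraph G H} \<subseteq> alpha3_bar_graph ` (Pow (fst H) \<times> Pow (snd H))"
    by (force simp: subgraph_def)
qed

text \<open>The complete tripartite graph itself can be taken as the host graph.\<close>

lemma card_le_alpha3_bar:
  assumes "triple_system m N P"
  shows "card P \<le> alpha3_bar m N"
proof -
  let ?K = "complete_tripartite m m N"
  have K: "simple_graph ?K" "subgraph ?K ?K"
    using simple_graph_complete_tripartite by (simp_all add: subgraph_def)
  have P: "P \<subseteq> {..<m} \<times> {..<m} \<times> {..<N}" using assms by (simp add: triple_system_def)
  have "induced_triangle_packing ?K (tri ` P)"
    by (subst induced_triangle_packing_tri_iff[OF P])
       (use P assms in \<open>auto simp: triangles_complete_tripartite\<close>)
  then have "card (tri ` P) \<le> alpha3_bar_graph ?K"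
    unfolding alpha3_bar_graph_def using K
    by (intro Max_ge finite_induced_triangle_packings) (auto simp: simple_graph_def)
  also have "\<dots> \<le> alpha3_bar m N"
    unfolding alpha3_bar_def using K
    by (intro Max_ge finite_subgraphs) blast+
  finally show ?thesis by (simp add: card_image inj_tri)
qed

text \<open>An optimal family in an optimal subgraph also consists of triangles of the complete
  tripartite graph, so it can be read as a set of triples.\<close>

lemma alpha3_bar_attained:
  obtains P where "triple_system m N P" "card P = alpha3_bar m N"
proof -
  let ?K = "complete_tripartite m m N"
  have K: "simple_graph ?K" "subgraph ?K ?K"
    using simple_graph_complete_tripartite by (simp_all add: subgraph_def)
  have "alpha3_bar m N \<in> {alpha3_bar_graph G |G. subgraph G ?K}"
    unfolding alpha3_bar_def using K
    by (intro Max_in finite_subgraphs) blast+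
  then obtain G where G: "subgraph G ?K" "alpha3_bar m N = alpha3_bar_graph G" by auto
  have "alpha3_bar_graph G \<in> {card F |F. induced_triangle_packing G F}"
    unfolding alpha3_bar_graph_def using G(1) induced_triangle_packing_empty[of G]
    by (intro Max_in finite_induced_triangle_packings) (auto simp: subgraph_def simple_graph_def)
  then obtain F where F: "alpha3_bar_graph G = card F" "induced_triangle_packing G F" by auto
  have FG: "F \<subseteq> triangles G" using F(2) by (simp add: induced_triangle_packing_def)
  also have "\<dots> \<subseteq> triangles ?K" using G(1) by (intro triangles_mono) (auto simp: subgraph_def)
  finally obtain P where P: "P \<subseteq> {..<m} \<times> {..<m} \<times> {..<N}" "F = tri ` P"
    unfolding triangles_complete_tripartite by (auto simp: subset_image_iff)
  have "triple_system m N P"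
    using induced_triangle_packing_tri_iff[OF P(1)] F(2) FG unfolding P(2) by blast
  moreover have "card P = alpha3_bar m N"
    using F(1) G(2) P(2) by (simp add: card_image inj_tri)
  ultimately show ?thesis by (rule that)
qed

section \<open>Balanced cuts\<close>

text \<open>Remove two vertices \<open>u\<close> and \<open>v\<close>, bisect the rest, and put \<open>u\<close> and \<open>v\<close> on opposite sides.
  The two ways of doing so together cut every edge between \<open>{u, v}\<close> and the rest exactly once.\<close>

lemma balanced_cut:
  fixes w :: "'a \<Rightarrow> 'a \<Rightarrow> nat"
  assumes sym: "\<And>a b. w a b = w b a" and irr: "\<And>a. w a a = 0" and "finite V"
  shows "\<exists>A B. A \<union> B = V \<and> A \<inter> B = {} \<and> card A = (card V + 1) div 2 \<and> card B = card V div 2 \<and>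
           (\<Sum>a\<in>V. \<Sum>b\<in>V. w a b) \<le> 4 * (\<Sum>a\<in>A. \<Sum>b\<in>B. w a b)"
  using \<open>finite V\<close>
\<comment> \<open>The factor 4 says that the cut carries at least half of the weight, because the
  double sum over \<open>V\<close> counts each edge twice.\<close>
proof (induction "card V" arbitrary: V rule: less_induct)
  case less
  note fin = \<open>finite V\<close>
  show ?case
  proof (cases "card V \<le> 1")
    case True
    then have V: "V = {} \<or> (\<exists>a. V = {a})"
      using fin by (metis card_0_eq card_1_singletonE le_less less_one)
    show ?thesis
      by (rule exI[of _ V], rule exI[of _ "{}"]) (use V irr in auto)
  next
    case False
    then obtain u where u: "u \<in> V" by (metis card.empty all_not_in_conv zero_le)
    then have "card (V - {u}) > 0" using False fin by simp
    then obtain v where v: "v \<in> V" "v \<noteq> u" by (metis DiffE card_gt_0_iff ex_in_conv singletonI)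
    define W where "W = V - {u, v}"
    have VW: "V = insert u (insert v W)" and nW: "u \<notin> W" "v \<notin> W" and finW: "finite W"
      using u v fin by (auto simp: W_def)
    have cV: "card V = card W + 2" using VW nW finW v by simp
    obtain A B where AB: "A \<union> B = W" "A \<inter> B = {}" "card A = (card W + 1) div 2"
        "card B = card W div 2" and le: "(\<Sum>a\<in>W. \<Sum>b\<in>W. w a b) \<le> 4 * (\<Sum>a\<in>A. \<Sum>b\<in>B. w a b)"
      using less(1)[of W] cV finW by auto
    have finAB: "finite A" "finite B" and nAB: "u \<notin> A" "v \<notin> A" "u \<notin> B" "v \<notin> B"
      using AB(1) finW nW by auto
    \<comment> \<open>Here \<open>p\<close>, \<open>q\<close> are the weights from \<open>u\<close>
      to \<open>A\<close>, \<open>B\<close>, then \<open>p'\<close>, \<open>q'\<close> those from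
      \<open>v\<close>, and \<open>c\<close> is the weight of the pair \<open>u\<close>,
      \<open>v\<close>. Putting \<open>u\<close> into \<open>A\<close> and \<open>v\<close> into
      \<open>B\<close> newly cuts \<open>q + p' + c\<close>, the other placement
      \<open>p + q' + c\<close>. The better of the two cuts at least half of
      \<open>p + q + p' + q'\<close>, and \<open>c\<close> is cut in either case.\<close>
    have bound: "x + 2 * (p + q) + 2 * (p' + q') + 2 * c \<le> 4 * (y + q + p' + c)"
      if "x \<le> 4 * y" "q' + p \<le> q + p'" for x y p q p' q' c :: nat
      using that by simp
    let ?e = "\<lambda>z X. \<Sum>a\<in>X. w z a"
    have sW: "?e z W = ?e z A + ?e z B" for z
      using AB(1,2) finAB by (metis sum.union_disjoint)
    have swap: "(\<Sum>a\<in>X. w a z) = ?e z X" for X z by (simp add: sym[of _ z])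
    have total: "(\<Sum>a\<in>V. \<Sum>b\<in>V. w a b) =
        (\<Sum>a\<in>W. \<Sum>b\<in>W. w a b) + 2 * ?e u W + 2 * ?e v W + 2 * w u v"
      using nW v finW by (simp add: VW irr sum.distrib swap sym[of v u])
    have cut: "(\<Sum>a\<in>insert p A. \<Sum>b\<in>insert q B. w a b) =
        (\<Sum>a\<in>A. \<Sum>b\<in>B. w a b) + ?e p B + ?e q A + w p q"
      if "p \<notin> A" "q \<notin> B" for p q
      using that finAB by (simp add: sum.distrib swap sym[of q p])
    have "\<exists>p q. {p, q} = {u, v} \<and> p \<noteq> q \<and>
        (\<Sum>a\<in>V. \<Sum>b\<in>V. w a b) \<le> 4 * (\<Sum>a\<in>insert p A. \<Sum>b\<in>insert q B. w a b)"
    proof (cases "?e u B + ?e v A \<ge> ?e v B + ?e u A")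
      case True
      then have "(\<Sum>a\<in>V. \<Sum>b\<in>V. w a b) \<le> 4 * (\<Sum>a\<in>insert u A. \<Sum>b\<in>insert v B. w a b)"
        unfolding total cut[OF nAB(1,4)] sW[of u] sW[of v] by (rule bound[OF le])
      then show ?thesis using v by blast
    next
      case False
      then have "(\<Sum>a\<in>V. \<Sum>b\<in>V. w a b) \<le> 4 * (\<Sum>a\<in>insert v A. \<Sum>b\<in>insert u B. w a b)"
        using bound[OF le, of "?e u B" "?e v A" "?e v B" "?e u A" "w u v"]
        unfolding total cut[OF nAB(2,3)] sW[of u] sW[of v] sym[of v u] by (simp add: ac_simps)
      then show ?thesis using v by blast
    qed
    then obtain p q where pq: "{p, q} = {u, v}" "p \<noteq> q"
        "(\<Sum>a\<in>V. \<Sum>b\<in>V. w a b) \<le> 4 * (\<Sum>a\<in>insert p A. \<Sum>b\<in>insert q B. w a b)" by blast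
    have nn: "p \<notin> A" "p \<notin> B" "q \<notin> A" "q \<notin> B" using pq(1) nAB by (auto simp: doubleton_eq_iff)
    show ?thesis
    proof (intro exI conjI)
      show "insert p A \<union> insert q B = V" using pq(1) AB(1) VW by auto
      show "insert p A \<inter> insert q B = {}" using nn AB(2) pq(2) by auto
      show "card (insert p A) = (card V + 1) div 2" "card (insert q B) = card V div 2"
        using nn finAB AB(3,4) cV by auto
    qed (rule pq(3))
  qed
qed

lemma card_ordered_edges:
  assumes "simple_graph G"
  shows "card {(a, b). {a, b} \<in> snd G} = 2 * card (snd G)"
proof -
  have E: "\<And>e. e \<in> snd G \<Longrightarrow> e \<subseteq> fst G \<and> card e = 2" and fin: "finite (fst G)"
    using assms by (auto simp: simple_graph_def)
  have finE: "finite (snd G)" by (rule finite_subset[of _ "Pow (fst G)"]) (use E fin in auto)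
  have two: "finite {(a, b). {a, b} = e} \<and> card {(a, b). {a, b} = e} = 2" if e: "e \<in> snd G" for e
  proof -
    obtain x y where xy: "e = {x, y}" "x \<noteq> y" using E[OF e] by (auto simp: card_2_iff)
    have "{(a, b). {a, b} = e} = {(x, y), (y, x)}" by (auto simp: xy(1) doubleton_eq_iff)
    then show ?thesis using xy(2) by simp
  qed
  have "{(a, b). {a, b} \<in> snd G} = (\<Union>e\<in>snd G. {(a, b). {a, b} = e})" by auto
  also have "card \<dots> = (\<Sum>e\<in>snd G. card {(a, b). {a, b} = e})"
    by (rule card_UN_disjoint) (use finE two in auto)
  finally show ?thesis using two by simp
qed

text \<open>This is \<open>balanced_cut\<close> for the adjacency weight. The total counts ordered
  pairs, that is, every edge twice, while a crossing edge gives one pair in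
  \<open>A \<times> B\<close> because the sides are disjoint; the factor 4 thus becomes 2.\<close>

lemma balanced_bipartition:
  assumes "simple_graph G"
  obtains A B where "A \<union> B = fst G" "A \<inter> B = {}" "card A = (card (fst G) + 1) div 2"
    "card B = card (fst G) div 2" "card (snd G) \<le> 2 * card {(a, b). a \<in> A \<and> b \<in> B \<and> {a, b} \<in> snd G}"
proof -
  have E: "\<And>e. e \<in> snd G \<Longrightarrow> e \<subseteq> fst G \<and> card e = 2" and fin: "finite (fst G)"
    using assms by (auto simp: simple_graph_def)
  define w :: "'a \<Rightarrow> 'a \<Rightarrow> nat" where "w a b = (if {a, b} \<in> snd G then 1 else 0)" for a b
  \<comment> \<open>\<open>{a, a}\<close> is a singleton, and edges have two elements.\<close>
  have "w a b = w b a" "w a a = 0" for a b using E[of "{a}"] by (auto simp: w_def insert_commute)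
  from balanced_cut[of w, OF this fin] obtain A B where AB: "A \<union> B = fst G" "A \<inter> B = {}"
      "card A = (card (fst G) + 1) div 2" "card B = card (fst G) div 2"
    and le: "(\<Sum>a\<in>fst G. \<Sum>b\<in>fst G. w a b) \<le> 4 * (\<Sum>a\<in>A. \<Sum>b\<in>B. w a b)" by blast
  have sums: "(\<Sum>a\<in>X. \<Sum>b\<in>Y. w a b) = card {(a, b). a \<in> X \<and> b \<in> Y \<and> {a, b} \<in> snd G}"
    if "finite X" "finite Y" for X Y
  proof -
    have "(\<Sum>a\<in>X. \<Sum>b\<in>Y. w a b) = (\<Sum>p\<in>X \<times> Y. if p \<in> {(a, b). {a, b} \<in> snd G} then 1 else 0)"
      by (auto simp: sum.cartesian_product w_def intro!: sum.cong)
    also have "\<dots> = card (X \<times> Y \<inter> {(a, b). {a, b} \<in> snd G})"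
      using that by (subst sum.inter_restrict[symmetric]) auto
    also have "X \<times> Y \<inter> {(a, b). {a, b} \<in> snd G} = {(a, b). a \<in> X \<and> b \<in> Y \<and> {a, b} \<in> snd G}"
      by auto
    finally show ?thesis .
  qed
  have "{(a, b). a \<in> fst G \<and> b \<in> fst G \<and> {a, b} \<in> snd G} = {(a, b). {a, b} \<in> snd G}"
    using E by fastforce
  then have "(\<Sum>a\<in>fst G. \<Sum>b\<in>fst G. w a b) = 2 * card (snd G)"
    using sums[OF fin fin] card_ordered_edges[OF assms] by simp
  moreover have "finite (A \<union> B)" using AB(1) fin by simp
  ultimately show ?thesis using le sums[of A B] AB that by force
qed

section \<open>From Ruzsa-Szemeredi graphs to triple systems\<close>

lemma Ruzsa_Szemeredi_card_edges:
  assumes "Ruzsa_Szemeredi r t G"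
  shows "card (snd G) = r * t"
proof -
  obtain M where M: "\<And>i. i < t \<Longrightarrow> induced_matching G (M i) \<and> card (M i) = r"
    "disjoint_family_on M {..<t}" "(\<Union>i<t. M i) = snd G" and G: "simple_graph G"
    using assms by (auto simp: Ruzsa_Szemeredi_def)
  have finE: "finite (snd G)"
    by (rule finite_subset[of _ "Pow (fst G)"]) (use G in \<open>auto simp: simple_graph_def\<close>)
  have "finite (M i)" if "i < t" for i
    by (rule finite_subset[OF _ finE]) (use M(3) that in blast)
  then have "card (snd G) = (\<Sum>i<t. card (M i))"
    unfolding M(3)[symmetric] using M(2)
    by (intro card_UN_disjoint) (auto simp: disjoint_family_on_def)
  then show ?thesis using M(1) by simp
qed

text \<open>Bisect the vertices so that at least half of the \<open>r * t\<close> edges cross, and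
  number both sides. The triple \<open>(x, y, i)\<close> records that the crossing edge
  \<open>xy\<close> lies in the matching \<open>M i\<close>. Disjointness of the family yields the
  first condition of a triple system, the matching property the next two, inducedness the
  last.\<close>

lemma Ruzsa_Szemeredi_imp_alpha3_bar:
  assumes "Ruzsa_Szemeredi r t G"
  shows "r * t \<le> 2 * alpha3_bar ((card (fst G) + 1) div 2) t"
proof -
  define m where "m = (card (fst G) + 1) div 2"
  obtain M where ind: "\<And>i. i < t \<Longrightarrow> induced_matching G (M i)"
    and dis: "disjoint_family_on M {..<t}" and un: "(\<Union>i<t. M i) = snd G" and G: "simple_graph G"
    using assms by (auto simp: Ruzsa_Szemeredi_def)
  obtain A B where AB: "A \<union> B = fst G" "A \<inter> B = {}" "card A = m"
    "card B = card (fst G) div 2" and cut: "card (snd G) \<le> 2 * card {(a, b). a \<in> A \<and> b \<in> B \<and> {a, b} \<in> snd G}"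
    using balanced_bipartition[OF G, folded m_def] by blast
  have "finite (A \<union> B)" using AB(1) G by (simp add: simple_graph_def)
  then have fin: "finite A" "finite B" by simp_all
  \<comment> \<open>The sides may differ in size by one, so both are merely injected into
    \<open>{..<m}\<close>.\<close>
  have "card B \<le> m" using AB(4) unfolding m_def by simp
  obtain f where f: "f ` A \<subseteq> {..<m}" "inj_on f A"
    using card_le_inj[of A "{..<m}"] fin AB(3) by auto
  obtain g where g: "g ` B \<subseteq> {..<m}" "inj_on g B"
    using card_le_inj[of B "{..<m}"] fin \<open>card B \<le> m\<close> by auto
  define P where "P = {(f a, g b, i) |a b i. a \<in> A \<and> b \<in> B \<and> i < t \<and> {a, b} \<in> M i}"
  have P_iff: "(f a, g b, i) \<in> P \<longleftrightarrow> i < t \<and> {a, b} \<in> M i" if ab: "a \<in> A" "b \<in> B" for a b i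
  proof
    assume "(f a, g b, i) \<in> P"
    then obtain a' b' where "f a = f a'" "g b = g b'" "a' \<in> A" "b' \<in> B" "i < t" "{a', b'} \<in> M i"
      unfolding P_def by blast
    then show "i < t \<and> {a, b} \<in> M i"
      using inj_onD[OF f(2), of a a'] inj_onD[OF g(2), of b b'] ab by simp
  qed (use ab in \<open>auto simp: P_def\<close>)
  have PE: "\<exists>a\<in>A. \<exists>b\<in>B. x = f a \<and> y = g b" if "(x, y, i) \<in> P" for x y i
    using that unfolding P_def by blast
  have share: "d = e" if "i < t" "d \<in> M i" "e \<in> M i" "z \<in> d" "z \<in> e" for d e i z
    using ind[OF that(1)] that(2-)
    unfolding induced_matching_def matching_def pairwise_def disjnt_def by blast
  have same: "i = j" if "i < t" "j < t" "e \<in> M i" "e \<in> M j" for i j e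
    using dis that unfolding disjoint_family_on_def by blast
  have closed: "e \<in> M i" if "i < t" "e \<in> snd G" "e \<subseteq> \<Union>(M i)" for e i
    using ind[OF that(1)] that(2,3) unfolding induced_matching_def by blast
  have "triple_system m t P"
    unfolding triple_system_def
  proof (intro conjI allI impI)
    show "P \<subseteq> {..<m} \<times> {..<m} \<times> {..<t}" using f(1) g(1) unfolding P_def by auto
  next
    fix x y i j assume p: "(x, y, i) \<in> P" "(x, y, j) \<in> P"
    from PE[OF p(1)] obtain a b where ab: "a \<in> A" "b \<in> B" "x = f a" "y = g b" by blast
    show "i = j" using same[of i j "{a, b}"] p by (simp add: ab P_iff)
  next
    fix x y z i assume p: "(x, y, i) \<in> P" "(x, z, i) \<in> P"
    from PE[OF p(1)] obtain a b where ab: "a \<in> A" "b \<in> B" "x = f a" "y = g b" by blast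
    from PE[OF p(2)] obtain c where c: "c \<in> B" "z = g c" by blast
    have "{a, b} = {a, c}" using share[of i "{a, b}" "{a, c}" a] p by (simp add: ab c P_iff)
    then show "y = z" using ab c by (auto simp: doubleton_eq_iff)
  next
    fix x y z i assume p: "(x, y, i) \<in> P" "(z, y, i) \<in> P"
    from PE[OF p(1)] obtain a b where ab: "a \<in> A" "b \<in> B" "x = f a" "y = g b" by blast
    from PE[OF p(2)] obtain c where c: "c \<in> A" "z = f c" by blast
    have "{a, b} = {c, b}" using share[of i "{a, b}" "{c, b}" b] p by (simp add: ab c P_iff)
    then show "x = z" using ab c by (auto simp: doubleton_eq_iff)
  next
    fix x y i x' y' j assume p: "(x, y, j) \<in> P" "(x, y', i) \<in> P" "(x', y, i) \<in> P"
    from PE[OF p(1)] obtain a b where ab: "a \<in> A" "b \<in> B" "x = f a" "y = g b" by blast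
    from PE[OF p(2)] obtain b' where b': "b' \<in> B" "y' = g b'" by blast
    from PE[OF p(3)] obtain a' where a': "a' \<in> A" "x' = f a'" by blast
    have M: "j < t" "{a, b} \<in> M j" "i < t" "{a, b'} \<in> M i" "{a', b} \<in> M i"
      using p by (simp_all add: ab a' b' P_iff)
    \<comment> \<open>The edge comes from \<open>M j\<close>, but both its ends are covered by
      \<open>M i\<close>; as \<open>M i\<close> is induced, the edge belongs to it.\<close>
    have "{a, b} \<in> snd G" using M(1,2) un by blast
    moreover have "{a, b} \<subseteq> \<Union>(M i)" using M(4,5) by blast
    ultimately show "(x, y, i) \<in> P" using closed M(3) by (simp add: ab P_iff)
  qed
  then have le: "card P \<le> alpha3_bar m t" by (rule card_le_alpha3_bar)
  let ?C = "{(a, b). a \<in> A \<and> b \<in> B \<and> {a, b} \<in> snd G}"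
  have "finite P" using \<open>triple_system m t P\<close> by (rule finite_triple_system)
  moreover have "inj_on (\<lambda>(a, b). (f a, g b)) ?C"
    using f(2) g(2) unfolding inj_on_def by clarsimp
  \<comment> \<open>Every crossing edge lies in some matching and so is the projection of a triple;
    hence there are at least as many triples as crossing edges.\<close>
  moreover have "(\<lambda>(a, b). (f a, g b)) ` ?C \<subseteq> (\<lambda>(x, y, i). (x, y)) ` P"
  proof clarify
    fix a b assume ab: "a \<in> A" "b \<in> B" "{a, b} \<in> snd G"
    then obtain i where "i < t" "{a, b} \<in> M i" using un by blast
    then have "(f a, g b, i) \<in> P" using ab by (simp add: P_iff)
    then show "(f a, g b) \<in> (\<lambda>(x, y, i). (x, y)) ` P" by force
  qed
  ultimately have "card ?C \<le> card P"
    by (meson card_image_le card_inj_on_le finite_imageI le_trans)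
  then show ?thesis
    using cut le Ruzsa_Szemeredi_card_edges[OF assms] unfolding m_def by linarith
qed

section \<open>Making the matchings equally large\<close>

text \<open>The pieces are removed greedily. Positivity of \<open>s\<close> keeps them nonempty, so
  that disjoint pieces are distinct and the set \<open>C\<close> really has \<open>k\<close>
  elements.\<close>

lemma disjoint_chunks:
  assumes "s > 0" "k * s \<le> card M"
  shows "\<exists>C. finite C \<and> card C = k \<and> disjoint C \<and> (\<forall>c\<in>C. c \<subseteq> M \<and> card c = s)"
  using assms(2)
proof (induction k arbitrary: M)
  case 0
  then show ?case by (intro exI[of _ "{}"]) auto
next
  case (Suc k)
  then have "s \<le> card M" by simp
  then obtain c where c: "c \<subseteq> M" "card c = s" "finite c"
    by (rule obtain_subset_with_card_n)
  then have "k * s \<le> card (M - c)" using Suc.prems by (simp add: card_Diff_subset)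
  then obtain C where C: "finite C" "card C = k" "disjoint C" "\<forall>d\<in>C. d \<subseteq> M - c \<and> card d = s"
    using Suc.IH by blast
  have sub: "d \<inter> c = {}" "d \<subseteq> M" "card d = s" if "d \<in> C" for d using C(4) that by blast+
  have "c \<noteq> {}" using c(2) assms(1) by auto
  then have "c \<notin> C" using sub(1)[of c] by blast
  moreover have "disjoint (insert c C)"
    using C(3) sub(1) unfolding pairwise_insert disjnt_def by blast
  ultimately show ?case
    using C(1,2) c sub(2,3) by (intro exI[of _ "insert c C"]) simp
qed

text \<open>An edge of \<open>H\<close> covered by \<open>M'\<close> is covered by \<open>M\<close>
  and thus lies in \<open>M\<close>. It shares a vertex with some edge of \<open>M'\<close>, and
  edges of a matching that meet are equal.\<close>

lemma induced_matching_subset: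
  assumes "induced_matching G M" "M' \<subseteq> M" "M' \<subseteq> snd H" "snd H \<subseteq> snd G" "\<And>e. e \<in> snd G \<Longrightarrow> e \<noteq> {}"
  shows "induced_matching H M'"
proof -
  have pw: "pairwise disjnt M" and ind: "{e \<in> snd G. e \<subseteq> \<Union>M} = M"
    using assms(1) by (auto simp: induced_matching_def matching_def)
  have "e \<in> M'" if e: "e \<in> snd H" "e \<subseteq> \<Union>M'" for e
  proof -
    have "e \<in> M" using e assms(2,4) ind by blast
    obtain z where z: "z \<in> e" using assms(4,5) e by blast
    then obtain d where d: "d \<in> M'" "z \<in> d" using e(2) by blast
    then have "e = d" using pw \<open>e \<in> M\<close> assms(2) z by (auto simp: pairwise_def disjnt_def)
    then show ?thesis using d by simp
  qed
  then show ?thesis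
    using pw assms(2,3) by (auto simp: induced_matching_def matching_def intro: pairwise_subset)
qed

text \<open>Cut each matching into as many pieces of size \<open>s\<close> as possible: at most \<open>s - 1\<close> edges are lost
  per matching, which leaves at least \<open>t\<close> pieces.\<close>

lemma Ruzsa_Szemeredi_of_large_matchings:
  assumes G: "simple_graph G" and ind: "\<And>i. i < t \<Longrightarrow> induced_matching G (M i)"
    and dis: "disjoint_family_on M {..<t}" and large: "t * (2 * s - 1) \<le> (\<Sum>i<t. card (M i))"
  obtains H where "Ruzsa_Szemeredi s t H" "fst H = fst G"
proof (cases "s = 0")
  case True
  \<comment> \<open>Pieces of size 0 cannot be told apart as sets, so this case takes the edgeless
    graph with \<open>t\<close> empty matchings.\<close>
  have "Ruzsa_Szemeredi s t (fst G, {})"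
    using G by (auto simp: True Ruzsa_Szemeredi_def simple_graph_def induced_matching_def
      matching_def disjoint_family_on_def intro!: exI[of _ "\<lambda>_. {}"])
  then show ?thesis using that by simp
next
  case False
  then have s: "s > 0" by simp
  have "\<exists>C. finite C \<and> card C = card (M i) div s \<and> disjoint C \<and> (\<forall>c\<in>C. c \<subseteq> M i \<and> card c = s)" for i
    by (rule disjoint_chunks[OF s div_times_less_eq_dividend])
  then obtain C where C: "\<And>i. finite (C i)" "\<And>i. card (C i) = card (M i) div s"
      "\<And>i. disjoint (C i)" "\<And>i c. c \<in> C i \<Longrightarrow> c \<subseteq> M i \<and> card c = s" by metis
  define D where "D = (\<Union>i<t. C i)"
  have ne: "c \<noteq> {}" if "c \<in> C i" for c i using C(4)[OF that] s by auto
  have disM: "M i \<inter> M j = {}" if "i < t" "j < t" "i \<noteq> j" for i j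
    using dis that by (auto simp: disjoint_family_on_def)
  have disD: "c \<inter> d = {}" if cd: "c \<in> D" "d \<in> D" "c \<noteq> d" for c d
  proof -
    obtain i j where ij: "i < t" "j < t" "c \<in> C i" "d \<in> C j" using cd by (auto simp: D_def)
    show ?thesis
    proof (cases "i = j")
      case True
      then show ?thesis using C(3)[of i] ij cd(3) by (auto simp: pairwise_def disjnt_def)
    next
      case False
      then show ?thesis using disM[of i j] ij C(4) by blast
    qed
  qed
  have "card D = (\<Sum>i<t. card (C i))"
    unfolding D_def
  proof (rule card_UN_disjoint)
    show "\<forall>i\<in>{..<t}. \<forall>j\<in>{..<t}. i \<noteq> j \<longrightarrow> C i \<inter> C j = {}"
    proof (intro ballI impI)
      fix i j assume "i \<in> {..<t}" "j \<in> {..<t}" "i \<noteq> j"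
      \<comment> \<open>A common piece would be a nonempty set of edges contained in both
        matchings.\<close>
      then have "M i \<inter> M j = {}" using disM by simp
      then show "C i \<inter> C j = {}" using C(4) ne by blast
    qed
  qed (use C(1) in auto)
  then have cardD: "card D = (\<Sum>i<t. card (M i) div s)" by (simp add: C(2))
  have "m \<le> s * (m div s) + (s - 1)" for m
    using mod_less_divisor[OF s, of m] mult_div_mod_eq[of s m] by linarith
  then have "(\<Sum>i<t. card (M i)) \<le> (\<Sum>i<t. s * (card (M i) div s) + (s - 1))"
    by (rule sum_mono)
  also have "\<dots> = s * card D + t * (s - 1)" by (simp add: sum.distrib cardD sum_distrib_left)
  finally have "t * (2 * s - 1) \<le> s * card D + t * (s - 1)" using large by linarith
  \<comment> \<open>Of the \<open>2 * s - 1\<close> edges per matching on average,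
    \<open>s - 1\<close> pay for the remainders; the other \<open>s\<close> suffice for one piece
    per matching on average.\<close>
  moreover have "t * (2 * s - 1) = s * t + t * (s - 1)"
    using s by (cases s) (auto simp: algebra_simps)
  ultimately have "s * t \<le> s * card D" by linarith
  then have "t \<le> card D" using s by simp
  have finD: "finite D" using C(1) by (auto simp: D_def)
  obtain h where h: "h ` {..<t} \<subseteq> D" "inj_on h {..<t}"
    using card_le_inj[of "{..<t}" D] finD \<open>t \<le> card D\<close> by auto
  \<comment> \<open>Edges outside the \<open>t\<close> selected pieces are dropped, so that these
    pieces partition the edge set. Several of them may come from the same matching.\<close>
  define H where "H = (fst G, \<Union>i<t. h i)"
  have hD: "\<exists>j<t. h i \<subseteq> M j \<and> card (h i) = s" if "i < t" for i
    using h(1) that C(4) unfolding D_def by blast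
  have MG: "M i \<subseteq> snd G" if "i < t" for i
    using ind[OF that] by (simp add: induced_matching_def matching_def)
  have HG: "snd H \<subseteq> snd G" using hD MG unfolding H_def by fastforce
  have "induced_matching H (h i)" if i: "i < t" for i
  proof -
    obtain j where j: "j < t" "h i \<subseteq> M j" using hD[OF i] by blast
    show ?thesis
      by (rule induced_matching_subset[OF ind[OF j(1)] j(2) _ HG])
         (use i G in \<open>auto simp: H_def simple_graph_def\<close>)
  qed
  moreover have "simple_graph H" using G HG by (auto simp: simple_graph_def H_def)
  moreover have "disjoint_family_on h {..<t}"
    unfolding disjoint_family_on_def
    using disD h by (metis image_subset_iff inj_on_eq_iff)
  ultimately have "Ruzsa_Szemeredi s t H"
    unfolding Ruzsa_Szemeredi_def using hD by (intro conjI exI[of _ h]) (auto simp: H_def)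
  then show ?thesis using that by (simp add: H_def)
qed

section \<open>From triple systems to Ruzsa-Szemeredi graphs\<close>

text \<open>The first two classes are placed side by side on \<open>{..<2 * n}\<close>, the second
  shifted by \<open>n\<close>, and \<open>(x, y, i)\<close> becomes the edge
  \<open>{x, n + y}\<close> of \<open>M i\<close>. This gives \<open>t\<close> disjoint induced
  matchings with \<open>card P\<close> edges in all, of possibly unequal sizes, which are then cut
  into pieces of size \<open>s\<close>.\<close>

lemma alpha3_bar_imp_Ruzsa_Szemeredi:
  assumes "t * (2 * s - 1) \<le> alpha3_bar n t"
  shows "\<exists>G :: nat graph. Ruzsa_Szemeredi s t G \<and> card (fst G) = 2 * n"
proof -
  obtain P where P: "triple_system n t P" and cardP: "card P = alpha3_bar n t"
    using alpha3_bar_attained .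
  have box: "\<And>x y i. (x, y, i) \<in> P \<Longrightarrow> x < n \<and> y < n \<and> i < t"
    and P1: "\<And>x y i j. (x, y, i) \<in> P \<Longrightarrow> (x, y, j) \<in> P \<Longrightarrow> i = j"
    and P2: "\<And>x y z i. (x, y, i) \<in> P \<Longrightarrow> (x, z, i) \<in> P \<Longrightarrow> y = z"
    and P3: "\<And>x y z i. (x, y, i) \<in> P \<Longrightarrow> (z, y, i) \<in> P \<Longrightarrow> x = z"
    and P4: "\<And>x y i x' y' j. (x, y, j) \<in> P \<Longrightarrow> (x, y', i) \<in> P \<Longrightarrow> (x', y, i) \<in> P \<Longrightarrow> (x, y, i) \<in> P"
    using P unfolding triple_system_def by blast+
  define M where "M i = {{x, n + y} |x y. (x, y, i) \<in> P}" for i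
  define G where "G = ({..<2 * n}, \<Union>i<t. M i)"
  have edge_eq: "{x, n + y} = {x', n + y'} \<longleftrightarrow> x = x' \<and> y = y'" if "x < n" "x' < n" for x y x' y'
    using that by (auto simp: doubleton_eq_iff)
  have M_iff: "{x, n + y} \<in> M i \<longleftrightarrow> (x, y, i) \<in> P" if "x < n" for x y i
  proof
    assume "{x, n + y} \<in> M i"
    then obtain x' y' where "{x, n + y} = {x', n + y'}" "(x', y', i) \<in> P" by (auto simp: M_def)
    then show "(x, y, i) \<in> P" using edge_eq[OF that] box by metis
  qed (auto simp: M_def)
  have ME: "\<exists>x y. e = {x, n + y} \<and> x < n \<and> y < n \<and> i < t \<and> (x, y, i) \<in> P" if "e \<in> M i" for e i
    using that box unfolding M_def by blast
  have G: "simple_graph G" unfolding simple_graph_def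
  proof (intro conjI ballI)
    fix e assume "e \<in> snd G"
    then obtain i where "e \<in> M i" by (auto simp: G_def)
    from ME[OF this] obtain x y where "e = {x, n + y}" "x < n" "y < n" by blast
    then show "e \<subseteq> fst G" "card e = 2" by (auto simp: G_def)
  qed (simp add: G_def)
  have "induced_matching G (M i)" if i: "i < t" for i
  proof -
    have "pairwise disjnt (M i)"
    proof (rule pairwiseI)
      fix d e assume de: "d \<in> M i" "e \<in> M i" "d \<noteq> e"
      obtain x y where d: "d = {x, n + y}" "x < n" "(x, y, i) \<in> P" using ME[OF de(1)] by blast
      obtain x' y' where e: "e = {x', n + y'}" "x' < n" "(x', y', i) \<in> P" using ME[OF de(2)] by blast
      have "x \<noteq> x'" "y \<noteq> y'" using P2 P3 d e de(3) by blast+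
      then show "disjnt d e" using d e by (auto simp: disjnt_def)
    qed
    moreover have "e \<in> M i" if e: "e \<in> snd G" "e \<subseteq> \<Union>(M i)" for e
    proof -
      obtain j where "e \<in> M j" using e(1) by (auto simp: G_def)
      from ME[OF this] obtain x y where xy: "e = {x, n + y}" "x < n" "y < n" "(x, y, j) \<in> P" by blast
      \<comment> \<open>Since \<open>x\<close> is covered by \<open>M i\<close>, some
        \<open>(x, y', i)\<close> is in \<open>P\<close>; since \<open>n + y\<close> is covered, so
        is some \<open>(x', y, i)\<close>. With \<open>(x, y, j)\<close> these are the three
        premises of \<open>P4\<close>.\<close>
      obtain d where d: "d \<in> M i" "x \<in> d" using e(2) xy(1) by blast
      then obtain y' where "(x, y', i) \<in> P" using ME[OF d(1)] xy(2) by auto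
      moreover obtain d' where d': "d' \<in> M i" "n + y \<in> d'" using e(2) xy(1) by blast
      then obtain x' where "(x', y, i) \<in> P" using ME[OF d'(1)] by auto
      ultimately show ?thesis using P4 xy M_iff by blast
    qed
    moreover have "M i \<subseteq> snd G" using i by (auto simp: G_def)
    ultimately show ?thesis by (auto simp: induced_matching_def matching_def)
  qed
  moreover have dis: "disjoint_family_on M {..<t}"
    unfolding disjoint_family_on_def using ME M_iff P1 by (metis Int_emptyI)
  moreover have "card P \<le> (\<Sum>i<t. card (M i))"
  proof -
    \<comment> \<open>The edge determines \<open>x\<close> and \<open>y\<close>, and these determine
      \<open>i\<close> by \<open>P1\<close>.\<close>
    have "inj_on (\<lambda>(x, y, i). {x, n + y}) P"
      using box P1 by (auto simp: inj_on_def edge_eq)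
    then have "card P = card ((\<lambda>(x, y, i). {x, n + y}) ` P)" by (simp add: card_image)
    also have "(\<lambda>(x, y, i). {x, n + y}) ` P = (\<Union>i<t. M i)"
    proof (intro equalityI subsetI)
      fix e assume "e \<in> (\<lambda>(x, y, i). {x, n + y}) ` P"
      then obtain x y i where e: "e = {x, n + y}" "(x, y, i) \<in> P" by auto
      then have "e \<in> M i" "i < t" using box unfolding M_def by blast+
      then show "e \<in> (\<Union>i<t. M i)" by blast
    next
      fix e assume "e \<in> (\<Union>i<t. M i)"
      then obtain i where "e \<in> M i" by blast
      from ME[OF this] obtain x y where e: "e = {x, n + y}" "(x, y, i) \<in> P" by blast
      then show "e \<in> (\<lambda>(x, y, i). {x, n + y}) ` P" by (intro image_eqI[OF _ e(2)]) simp
    qed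
    also have "card \<dots> \<le> (\<Sum>i<t. card (M i))" by (rule card_UN_le) simp
    finally show ?thesis .
  qed
  ultimately obtain H where "Ruzsa_Szemeredi s t H" "fst H = fst G"
    using Ruzsa_Szemeredi_of_large_matchings[OF G, of t M s] assms cardP by (metis le_trans)
  moreover from this have "card (fst H) = 2 * n" by (simp add: G_def)
  ultimately show ?thesis by blast
qed

text \<open>Both halves are rounded up: the larger side of a bisection of \<open>n\<close> vertices
  needs that much room, and matchings of average size \<open>r\<close> still suffice for pieces of
  the rounded size. The second graph has \<open>2 * n\<close> vertices because it joins two classes
  of \<open>n\<close> vertices each.\<close>

theorem lemma17:
  fixes n r t :: nat
  shows "((\<exists>G :: 'a graph. Ruzsa_Szemeredi r t G \<and> card (fst G) = n) \<longrightarrow>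
            real (alpha3_bar (nat \<lceil>real n / 2\<rceil>) t) \<ge> real r * real t / 2) \<and>
         (alpha3_bar n t \<ge> r * t \<longrightarrow>
            (\<exists>G :: nat graph. Ruzsa_Szemeredi (nat \<lceil>real r / 2\<rceil>) t G \<and> card (fst G) = 2 * n))"
proof (intro conjI impI)
  have half: "nat \<lceil>real k / 2\<rceil> = (k + 1) div 2" for k by linarith
  {
    assume "\<exists>G :: 'a graph. Ruzsa_Szemeredi r t G \<and> card (fst G) = n"
    then have "r * t \<le> 2 * alpha3_bar ((n + 1) div 2) t"
      using Ruzsa_Szemeredi_imp_alpha3_bar by blast
    then have "real (r * t) \<le> real (2 * alpha3_bar ((n + 1) div 2) t)" by (rule of_nat_mono)
    then show "real (alpha3_bar (nat \<lceil>real n / 2\<rceil>) t) \<ge> real r * real t / 2"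
      unfolding half by simp
  next
    assume "alpha3_bar n t \<ge> r * t"
    \<comment> \<open>Rounding up costs nothing because cutting into pieces of size \<open>s\<close>
      needs an average of only \<open>2 * s - 1\<close>, which equals \<open>r\<close> when
      \<open>r\<close> is odd.\<close>
    have "2 * ((r + 1) div 2) - 1 \<le> r" by linarith
    then have "t * (2 * ((r + 1) div 2) - 1) \<le> r * t" by (subst mult.commute[of r]) (rule mult_le_mono2)
    also have "\<dots> \<le> alpha3_bar n t" by fact
    finally show "\<exists>G :: nat graph. Ruzsa_Szemeredi (nat \<lceil>real r / 2\<rceil>) t G \<and> card (fst G) = 2 * n"
      unfolding half by (rule alpha3_bar_imp_Ruzsa_Szemeredi)
  }
qed

end
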